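(* Assume that the families $D_0(c_0), D_1(c_1)$ satisfy conditions (1)–(4) listed in the context. Let $u\in I_2(\Omega)$ be an input signal and define two scalar signals by $K_0(t)=c_0(u(t))$ and $K_1(t)=c_1(u(t))$. Let $(c_0,c_1)$ be an admissible pair. Then the relay operator $R^{c_0c_1}$ can be expressed as follows: (i) if $K_0(t)<c_0$ and $K_1(t)<c_1$, then $(R^{c_0c_1}u)(t)=(R^{c_0c_1}u)(t^-)$; (ii) it is not possible to have both $K_0(t)>c_0$ and $K_1(t)>c_1$; (iii) if $K_0(t)>c_0$ and $K_1(t)<c_1$, then $(R^{c_0c_1}u)(t)=1$; (iv) if $K_0(t)<c_0$ and $K_1(t)>c_1$, then $(R^{c_0c_1}u)(t)=0$.
   Context: Let $\Omega\subseteq\mathbb{R}^2$ be open and $T>0$. $I_2(\Omega)$ is the set of continuous functions $u:[0,T]\to\Omega$ (input signals). Relay operator. Let $D_0,D_1\subseteq\Omega$ be open with $D_0\cup D_1=\Omega$, and suppose the relative boundaries $(\gamma_i):=\Omega\cap\partial D_i$ ($i=0,1$) are continuous curves. For $u\in I_2(\Omega)$, the relay output $(Ru)(t)$ takes values in $\{0,1\}$; at the initial time, $(Ru)(0)=i$ implies $u(0)\in D_i$; $t\mapsto (Ru)(t)$ is right-continuous with left limits; its value changes exactly at the moments of exit of $u$ from the sets $D_i$: if $(Ru)(t^-)=i$ and $u(t)\in(\gamma_i)$ then $(Ru)(t)=(i+1)\bmod 2$. Here $f(t^-)$ is the left limit of $f$ at $t$ (so (i) is understood for $t>0$). Families. Consider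 two one-parameter families (with real parameters) of open subsets $D_0(c_0)$, $D_1(c_1)$ of $\Omega$, with $\gamma_i(c_i):=\Omega\cap\partial D_i(c_i)$ continuous curves. A pair $(c_0,c_1)$ is admissible if $D_0(c_0)\cup D_1(c_1)=\Omega$. For an admissible pair (and an initial value $(R^{c_0c_1}u)(0)=i_0\in\{0,1\}$ such that $u(0)\in D_{i_0}(c_{i_0})$), $R^{c_0c_1}$ is the relay operator relative to $D_0(c_0),D_1(c_1)$. Conditions: (1) Every point $x\in\Omega$ belongs to exactly one curve $\gamma_0(c_0)$ and to exactly one curve $\gamma_1(c_1)$; the corresponding parameters are denoted $c_0(x)$ and $c_1(x)$. (2) For each $i$ and $c_i\ne c_i'$, exactly one of $D_i(c_i)\subsetneq D_i(c_i')$, $D_i(c_i')\subsetneq D_i(c_i)$ holds. (3) $c_i<c_i'$ if $D_i(c_i)\subsetneq D_i(c_i')$ ($i=0,1$). (4) For all $x,x'\in\Omega$: $c_0(x)<c_0(x')\Leftrightarrow c_1(x)>c_1(x')$. *)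

theory Defs
  imports "HOL-Analysis.Analysis"
begin

definition input_signals :: "real \<Rightarrow> (real^2) set \<Rightarrow> (real \<Rightarrow> real^2) set" where
  "input_signals T \<Omega> = {u. continuous_on {0..T} u \<and> u ` {0..T} \<subseteq> \<Omega>}"

definition rel_boundary :: "(real^2) set \<Rightarrow> (real^2) set \<Rightarrow> (real^2) set" where
  "rel_boundary \<Omega> D = \<Omega> \<inter> frontier D"

text \<open>The parameter interval may be open, half-open or unbounded, so that curves running
  to the boundary of \<open>\<Omega>\<close> or to infinity are included.\<close>

definition continuous_curve :: "(real^2) set \<Rightarrow> bool" where
  "continuous_curve S \<longleftrightarrow>
     (\<exists>(I :: real set) f. is_interval I \<and> I \<noteq> {} \<and> continuous_on I f \<and> S = f ` I)"

definition left_limit :: "(real \<Rightarrow> nat) \<Rightarrow> real \<Rightarrow> nat" where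
  "left_limit r t = Lim (at_left t) r"

definition relay_set :: "(real^2) set \<Rightarrow> (real^2) set \<Rightarrow> nat \<Rightarrow> (real^2) set" where
  "relay_set D0 D1 i = (if i = 0 then D0 else D1)"

text \<open>\<open>relay_output T \<Omega> D0 D1 i0 u r\<close> says that \<open>r = R u\<close>, where \<open>R\<close> is the relay operator
  relative to \<open>D0, D1\<close> with initial value \<open>i0\<close>; only the restriction of \<open>r\<close> to \<open>{0..T}\<close> matters.
  The last clause renders ``the value changes exactly at the moments of exit'': it prescribes the
  switch on the relative boundary and also forbids any other switch.\<close>

definition relay_output ::
  "real \<Rightarrow> (real^2) set \<Rightarrow> (real^2) set \<Rightarrow> (real^2) set \<Rightarrow> nat \<Rightarrow> (real \<Rightarrow> real^2) \<Rightarrow> (real \<Rightarrow> nat) \<Rightarrow> bool"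
where
  "relay_output T \<Omega> D0 D1 i0 u r \<longleftrightarrow>
     (\<forall>t\<in>{0..T}. r t \<in> {0, 1}) \<and>
     r 0 = i0 \<and> u 0 \<in> relay_set D0 D1 i0 \<and>
     (\<forall>t\<in>{0..<T}. continuous (at_right t) r) \<and>
     (\<forall>t\<in>{0<..T}. \<exists>l. (r \<longlongrightarrow> l) (at_left t)) \<and>
     (\<forall>t\<in>{0<..T}. \<forall>i\<in>{0, 1}. left_limit r t = i \<longrightarrow>
        r t = (if u t \<in> rel_boundary \<Omega> (relay_set D0 D1 i) then (i + 1) mod 2 else i))"

text \<open>A family \<open>D\<close> is indexed by an arbitrary set \<open>P\<close> of real parameters: for bounded \<open>\<Omega>\<close>
  the parameters typically fill only an interval.\<close>

definition curve_family :: "(real^2) set \<Rightarrow> real set \<Rightarrow> (real \<Rightarrow> (real^2) set) \<Rightarrow> bool" where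
  "curve_family \<Omega> P D \<longleftrightarrow>
     (\<forall>c\<in>P. open (D c) \<and> D c \<subseteq> \<Omega> \<and> continuous_curve (rel_boundary \<Omega> (D c)))"

definition admissible_pair ::
  "(real^2) set \<Rightarrow> real set \<Rightarrow> (real \<Rightarrow> (real^2) set) \<Rightarrow> real set \<Rightarrow> (real \<Rightarrow> (real^2) set) \<Rightarrow> real \<Rightarrow> real \<Rightarrow> bool"
where
  "admissible_pair \<Omega> P0 D0 P1 D1 c0 c1 \<longleftrightarrow> c0 \<in> P0 \<and> c1 \<in> P1 \<and> D0 c0 \<union> D1 c1 = \<Omega>"

definition unique_curve_through :: "(real^2) set \<Rightarrow> real set \<Rightarrow> (real \<Rightarrow> (real^2) set) \<Rightarrow> bool" where
  "unique_curve_through \<Omega> P D \<longleftrightarrow> (\<forall>x\<in>\<Omega>. \<exists>!c. c \<in> P \<and> x \<in> rel_boundary \<Omega> (D c))"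

definition curve_param :: "(real^2) set \<Rightarrow> real set \<Rightarrow> (real \<Rightarrow> (real^2) set) \<Rightarrow> real^2 \<Rightarrow> real" where
  "curve_param \<Omega> P D x = (THE c. c \<in> P \<and> x \<in> rel_boundary \<Omega> (D c))"

text \<open>Below, \<open>\<noteq>\<close> between propositions expresses ``exactly one of''.\<close>

definition strictly_nested :: "real set \<Rightarrow> (real \<Rightarrow> (real^2) set) \<Rightarrow> bool" where
  "strictly_nested P D \<longleftrightarrow>
     (\<forall>c\<in>P. \<forall>c'\<in>P. c \<noteq> c' \<longrightarrow> (D c \<subset> D c') \<noteq> (D c' \<subset> D c))"

definition order_compatible :: "real set \<Rightarrow> (real \<Rightarrow> (real^2) set) \<Rightarrow> bool" where
  "order_compatible P D \<longleftrightarrow> (\<forall>c\<in>P. \<forall>c'\<in>P. D c \<subset> D c' \<longrightarrow> c < c')"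

definition opposite_orders ::
  "(real^2) set \<Rightarrow> real set \<Rightarrow> (real \<Rightarrow> (real^2) set) \<Rightarrow> real set \<Rightarrow> (real \<Rightarrow> (real^2) set) \<Rightarrow> bool"
where
  "opposite_orders \<Omega> P0 D0 P1 D1 \<longleftrightarrow>
     (\<forall>x\<in>\<Omega>. \<forall>x'\<in>\<Omega>.
        curve_param \<Omega> P0 D0 x < curve_param \<Omega> P0 D0 x' \<longleftrightarrow>
        curve_param \<Omega> P1 D1 x > curve_param \<Omega> P1 D1 x')"

end

theory Submission
  imports Defs
begin

text \<open>A point \<open>x\<close> lies on the boundary of the open set \<open>D k\<close> whose parameter \<open>k\<close> is that of
  the curve through \<open>x\<close>, so it is not in \<open>D k\<close>. Since the sets \<open>D c\<close> increase with \<open>c\<close>, it is not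
  in \<open>D c\<close> either when \<open>c < k\<close> (\<open>notin_of_param_greater\<close>). Consequently \<open>K0 t > c0\<close> and
  \<open>K1 t > c1\<close> put the input \<open>u t\<close> outside \<open>D0 c0\<close> and \<open>D1 c1\<close> respectively, and they exclude each
  other because the two sets cover \<open>\<Omega>\<close>. If both inequalities are reversed, \<open>u t\<close> is on neither
  boundary, as only one curve of each family passes through it, and the relay does not switch.

  In the two remaining cases \<open>u t\<close> lies outside one of the two sets, and the output is
  determined by the invariant that \<open>u t\<close> always lies in the set selected by the current output
  (\<open>relay_output_in_relay_set\<close>). The invariant follows by induction along the time
  interval. It holds initially and, the sets being open and the output being locally constant to
  the right, it persists for a short time. If it holds before \<open>t\<close>, then near \<open>t\<close> on the left the
  output is a constant \<open>i\<close>, so that \<open>u t\<close> is in the closure of the set with index \<open>i\<close>: either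
  \<open>u t\<close> is still in this set and the output stays \<open>i\<close>, or \<open>u t\<close> is on its boundary, the output
  switches, and \<open>u t\<close> belongs to the other set by the covering property.\<close>

lemma real_interval_induct [consumes 1, case_names left start right]:
  fixes a b t :: real
  assumes t: "t \<in> {a..b}"
    and left: "\<And>t. t \<in> {a<..b} \<Longrightarrow> (\<And>s. s \<in> {a..<t} \<Longrightarrow> Q s) \<Longrightarrow> Q t"
    and start: "Q a"
    and right: "\<And>t. t \<in> {a..<b} \<Longrightarrow> Q t \<Longrightarrow> eventually Q (at_right t)"
  shows "Q t"
proof (rule ccontr)
  assume "\<not> Q t"
  define B where "B = {s \<in> {a..b}. \<not> Q s}"
  define m where "m = Inf B"
  have "t \<in> B"
    using t \<open>\<not> Q t\<close> by (simp add: B_def)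
  have bdd: "bdd_below B"
    unfolding B_def by (rule bdd_belowI[of _ a]) auto
  have m_le: "m \<le> s" if "s \<in> B" for s
    unfolding m_def using bdd that by (rule cInf_lower[rotated])
  have "a \<le> m"
    unfolding m_def using \<open>t \<in> B\<close> by (intro cInf_greatest) (auto simp: B_def)
  have "m \<le> b"
    using m_le[OF \<open>t \<in> B\<close>] t by auto
  have before: "Q s" if "s \<in> {a..<m}" for s
  proof (rule ccontr)
    assume "\<not> Q s"
    then have "s \<in> B"
      using that \<open>m \<le> b\<close> by (auto simp: B_def)
    then show False
      using m_le[of s] that by auto
  qed
  have "Q m"
    using left[of m] start before \<open>a \<le> m\<close> \<open>m \<le> b\<close> by (cases "m = a") auto
  have "m < b"
  proof (rule ccontr)
    assume "\<not> m < b"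
    then have "t = m"
      using m_le[OF \<open>t \<in> B\<close>] t by auto
    then show False
      using \<open>Q m\<close> \<open>\<not> Q t\<close> by simp
  qed
  then have "eventually Q (at_right m)"
    using right[of m] \<open>Q m\<close> \<open>a \<le> m\<close> by auto
  then obtain d where "m < d" and d: "\<And>s. m < s \<Longrightarrow> s < d \<Longrightarrow> Q s"
    by (auto simp: eventually_at_right_field)
  obtain s where "s \<in> B" "s < d"
    using cInf_lessD[of B d] \<open>t \<in> B\<close> \<open>m < d\<close> by (auto simp: m_def)
  then have "Q s"
    using d[of s] m_le[of s] \<open>Q m\<close> by (cases "s = m") auto
  then show False
    using \<open>s \<in> B\<close> by (simp add: B_def)
qed

lemma curve_param:
  assumes "unique_curve_through \<Omega> P D" "x \<in> \<Omega>"
  shows "curve_param \<Omega> P D x \<in> P" "x \<in> rel_boundary \<Omega> (D (curve_param \<Omega> P D x))"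
  using theI'[of "\<lambda>c. c \<in> P \<and> x \<in> rel_boundary \<Omega> (D c)"] assms
  by (auto simp: unique_curve_through_def curve_param_def)

lemma curve_param_eqI:
  assumes "unique_curve_through \<Omega> P D" "c \<in> P" "x \<in> rel_boundary \<Omega> (D c)"
  shows "curve_param \<Omega> P D x = c"
proof -
  have "x \<in> \<Omega>"
    using assms(3) by (simp add: rel_boundary_def)
  then show ?thesis
    using curve_param[OF assms(1), of x] assms unfolding unique_curve_through_def by blast
qed

lemma psubset_of_param_less:
  assumes "strictly_nested P D" "order_compatible P D" "c \<in> P" "c' \<in> P" "c < c'"
  shows "D c \<subset> D c'"
proof -
  have "\<not> D c' \<subset> D c"
    using assms(2-5) unfolding order_compatible_def by (meson order.asym)
  moreover have "(D c \<subset> D c') \<noteq> (D c' \<subset> D c)"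
    by (rule assms(1)[unfolded strictly_nested_def, rule_format]) (use assms(3-5) in auto)
  ultimately show ?thesis
    by blast
qed

lemma notin_of_param_greater:
  assumes uniq: "unique_curve_through \<Omega> P D" and fam: "curve_family \<Omega> P D"
    and nest: "strictly_nested P D" "order_compatible P D"
    and "c \<in> P" "x \<in> \<Omega>" and less: "c < curve_param \<Omega> P D x"
  shows "x \<notin> D c"
proof -
  let ?k = "curve_param \<Omega> P D x"
  have k: "?k \<in> P" "x \<in> rel_boundary \<Omega> (D ?k)"
    using curve_param[OF uniq \<open>x \<in> \<Omega>\<close>] by auto
  have "D c \<subset> D ?k"
    by (rule psubset_of_param_less) (use assms k in auto)
  moreover have "x \<notin> D ?k"
    using k fam by (auto simp: curve_family_def rel_boundary_def frontier_def interior_open)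
  ultimately show ?thesis
    by auto
qed

lemma relay_output_left_limit:
  assumes "relay_output T \<Omega> D0 D1 i0 u r" "t \<in> {0<..T}"
  shows "left_limit r t \<in> {0, 1}" "\<forall>\<^sub>F s in at_left t. r s = left_limit r t"
proof -
  obtain l where l: "(r \<longlongrightarrow> l) (at_left t)"
    using assms unfolding relay_output_def by blast
  then have "left_limit r t = l"
    unfolding left_limit_def by (intro tendsto_Lim) auto
  then show ev: "\<forall>\<^sub>F s in at_left t. r s = left_limit r t"
    using l by (simp add: tendsto_discrete)
  have "\<forall>\<^sub>F s in at_left t. s \<in> {0<..<t}"
    using assms(2) by (intro eventually_at_leftI[of 0]) auto
  then have "\<forall>\<^sub>F s in at_left t. r s \<in> {0, 1}"
    by (rule eventually_mono) (use assms in \<open>auto simp: relay_output_def\<close>)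
  with ev have "\<forall>\<^sub>F s in at_left t. left_limit r t \<in> {0, 1}"
    by eventually_elim simp
  then show "left_limit r t \<in> {0, 1}"
    by (simp del: insert_iff)
qed

lemma relay_output_no_switch:
  assumes "relay_output T \<Omega> D0 D1 i0 u r" "t \<in> {0<..T}"
    and "u t \<notin> rel_boundary \<Omega> D0" "u t \<notin> rel_boundary \<Omega> D1"
  shows "r t = left_limit r t"
proof -
  have "u t \<notin> rel_boundary \<Omega> (relay_set D0 D1 (left_limit r t))"
    using assms by (simp add: relay_set_def)
  then show ?thesis
    using assms(1,2) relay_output_left_limit(1)[OF assms(1,2)] by (auto simp: relay_output_def)
qed

lemma relay_output_in_relay_set:
  assumes relay: "relay_output T \<Omega> D0 D1 i0 u r"
    and op: "open D0" "open D1" and cover: "D0 \<union> D1 = \<Omega>"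
    and u: "u \<in> input_signals T \<Omega>" and t: "t \<in> {0..T}"
  shows "u t \<in> relay_set D0 D1 (r t)"
  using t
proof (induction rule: real_interval_induct)
  case start
  show ?case
    using relay by (auto simp: relay_output_def)
next
  case (right t)
  have "(r \<longlongrightarrow> r t) (at_right t)"
    using relay right(1) by (simp add: relay_output_def continuous_within)
  then have ev: "\<forall>\<^sub>F s in at_right t. r s = r t"
    by (simp add: tendsto_discrete)
  have "(u \<longlongrightarrow> u t) (at t within {0..T})"
    using u right(1) by (auto simp: input_signals_def continuous_on_def)
  then have "(u \<longlongrightarrow> u t) (at t within {t..T})"
    by (rule tendsto_within_subset) (use right(1) in auto)
  then have "(u \<longlongrightarrow> u t) (at_right t)"
    using right(1) by (simp add: at_within_Icc_at_right)
  moreover have "open (relay_set D0 D1 (r t))"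
    using op by (simp add: relay_set_def)
  ultimately have "\<forall>\<^sub>F s in at_right t. u s \<in> relay_set D0 D1 (r t)"
    using right(2) by (rule topological_tendstoD)
  with ev show ?case
    by eventually_elim simp
next
  case (left t)
  define i where "i = left_limit r t"
  have i: "i \<in> {0, 1}" and ev: "\<forall>\<^sub>F s in at_left t. r s = i"
    using relay_output_left_limit[OF relay left(1)] by (auto simp: i_def)
  have rt: "r t = (if u t \<in> rel_boundary \<Omega> (relay_set D0 D1 i) then (i + 1) mod 2 else i)"
    using relay left(1) i unfolding relay_output_def i_def by blast
  have "u t \<in> \<Omega>"
    using u left(1) by (auto simp: input_signals_def)
  have "\<forall>\<^sub>F s in at_left t. s \<in> {0<..<t}"
    using left(1) by (intro eventually_at_leftI[of 0]) auto
  with ev have in_set: "\<forall>\<^sub>F s in at_left t. u s \<in> closure (relay_set D0 D1 i)"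
  proof eventually_elim
    case (elim s)
    then show ?case
      using left(2)[of s] closure_subset[of "relay_set D0 D1 i"] by auto
  qed
  have "(u \<longlongrightarrow> u t) (at t within {0..T})"
    using u left(1) by (auto simp: input_signals_def continuous_on_def)
  then have "(u \<longlongrightarrow> u t) (at t within {0..t})"
    by (rule tendsto_within_subset) (use left(1) in auto)
  then have "(u \<longlongrightarrow> u t) (at_left t)"
    using left(1) by (simp add: at_within_Icc_at_left)
  then have clos: "u t \<in> closure (relay_set D0 D1 i)"
    using in_set by (intro Lim_in_closed_set[OF closed_closure]) auto
  show ?case
  proof (cases "u t \<in> relay_set D0 D1 i")
    case True
    then have "u t \<notin> rel_boundary \<Omega> (relay_set D0 D1 i)"
      using op by (auto simp: rel_boundary_def frontier_def interior_open relay_set_def)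
    then show ?thesis
      using True rt by simp
  next
    case False
    then have "u t \<in> rel_boundary \<Omega> (relay_set D0 D1 i)"
      using clos \<open>u t \<in> \<Omega>\<close> interior_subset[of "relay_set D0 D1 i"]
      by (auto simp: rel_boundary_def frontier_def)
    then show ?thesis
      using False rt i cover \<open>u t \<in> \<Omega>\<close> by (auto simp: relay_set_def)
  qed
qed

theorem theorem2p2:
  fixes \<Omega> :: "(real^2) set" and T :: real
    and P0 P1 :: "real set" and D0 D1 :: "real \<Rightarrow> (real^2) set"
    and u :: "real \<Rightarrow> real^2" and K0 K1 :: "real \<Rightarrow> real" and c0 c1 :: real
  assumes "open \<Omega>" and "T > 0"
    and "curve_family \<Omega> P0 D0" and "curve_family \<Omega> P1 D1"
    and "unique_curve_through \<Omega> P0 D0" and "unique_curve_through \<Omega> P1 D1"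
    and "strictly_nested P0 D0" and "strictly_nested P1 D1"
    and "order_compatible P0 D0" and "order_compatible P1 D1"
    and "opposite_orders \<Omega> P0 D0 P1 D1"
    and "u \<in> input_signals T \<Omega>"
    and "\<And>t. t \<in> {0..T} \<Longrightarrow> K0 t = curve_param \<Omega> P0 D0 (u t)"
    and "\<And>t. t \<in> {0..T} \<Longrightarrow> K1 t = curve_param \<Omega> P1 D1 (u t)"
    and "admissible_pair \<Omega> P0 D0 P1 D1 c0 c1"
  shows "(\<forall>i0 r. relay_output T \<Omega> (D0 c0) (D1 c1) i0 u r \<longrightarrow>
            (\<forall>t\<in>{0<..T}. K0 t < c0 \<and> K1 t < c1 \<longrightarrow> r t = left_limit r t) \<and>
            (\<forall>t\<in>{0..T}. K0 t > c0 \<and> K1 t < c1 \<longrightarrow> r t = 1) \<and>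
            (\<forall>t\<in>{0..T}. K0 t < c0 \<and> K1 t > c1 \<longrightarrow> r t = 0)) \<and>
         (\<forall>t\<in>{0..T}. \<not> (K0 t > c0 \<and> K1 t > c1))"
proof -
  have P: "c0 \<in> P0" "c1 \<in> P1" and cover: "D0 c0 \<union> D1 c1 = \<Omega>"
    using assms(15) by (auto simp: admissible_pair_def)
  have op: "open (D0 c0)" "open (D1 c1)"
    using assms(3,4) P by (auto simp: curve_family_def)
  have u: "u t \<in> \<Omega>" if "t \<in> {0..T}" for t
    using assms(12) that by (auto simp: input_signals_def)
  have greater0: "u t \<notin> D0 c0" if "t \<in> {0..T}" "K0 t > c0" for t
    using notin_of_param_greater[OF assms(5,3,7,9) P(1) u[OF that(1)]] assms(13) that by simp
  have greater1: "u t \<notin> D1 c1" if "t \<in> {0..T}" "K1 t > c1" for t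
    using notin_of_param_greater[OF assms(6,4,8,10) P(2) u[OF that(1)]] assms(14) that by simp
  have less0: "u t \<notin> rel_boundary \<Omega> (D0 c0)" if "t \<in> {0..T}" "K0 t < c0" for t
    using curve_param_eqI[OF assms(5) P(1)] assms(13) that by fastforce
  have less1: "u t \<notin> rel_boundary \<Omega> (D1 c1)" if "t \<in> {0..T}" "K1 t < c1" for t
    using curve_param_eqI[OF assms(6) P(2)] assms(14) that by fastforce
  show ?thesis
  proof (intro conjI allI impI ballI)
    fix t
    assume "t \<in> {0..T}"
    then show "\<not> (K0 t > c0 \<and> K1 t > c1)"
      using greater0 greater1 u cover by blast
  next
    fix i0 r t
    assume relay: "relay_output T \<Omega> (D0 c0) (D1 c1) i0 u r"
      and "t \<in> {0<..T}" "K0 t < c0 \<and> K1 t < c1"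
    then show "r t = left_limit r t"
      using less0[of t] less1[of t] by (intro relay_output_no_switch[OF relay]) auto
  next
    fix i0 r t
    assume relay: "relay_output T \<Omega> (D0 c0) (D1 c1) i0 u r"
      and t: "t \<in> {0..T}" "K0 t > c0 \<and> K1 t < c1"
    have "r t \<in> {0, 1}"
      using relay t by (simp add: relay_output_def)
    then show "r t = 1"
      using relay_output_in_relay_set[OF relay op cover assms(12) t(1)] greater0[of t] t
      by (auto simp: relay_set_def)
  next
    fix i0 r t
    assume relay: "relay_output T \<Omega> (D0 c0) (D1 c1) i0 u r"
      and t: "t \<in> {0..T}" "K0 t < c0 \<and> K1 t > c1"
    have "r t \<in> {0, 1}"
      using relay t by (simp add: relay_output_def)
    then show "r t = 0"
      using relay_output_in_relay_set[OF relay op cover assms(12) t(1)] greater1[of t] t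
      by (auto simp: relay_set_def)
  qed
qed

end
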